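(* For any pair of policies $\pi,\pi'\in\Pi$ and every state $s\in\mathcal S$, $$V^{\pi'}_r(s)-V^{\pi}_r(s)\ \le\ \frac{1}{1-\gamma}\,\mathbb E_{s'\sim d^{\pi',u_{\pi'}}_s}\big\langle Q^\pi_r,\pi'-\pi\big\rangle_{s'} .$$
   Context: Robust MDP. $\mathcal S,\mathcal A$ are finite nonempty state and action sets, $c:\mathcal S\times\mathcal A\to\mathbb R$ is a cost with $0<c(s,a)\le1$, $\gamma\in(0,1)$ is the discount factor, and $\mathbb P_{N}$ is a nominal transition kernel ($\mathbb P_N(\cdot|s,a)\in\Delta_{\mathcal S}$, the probability simplex). The uncertainty set $\mathcal U\subset\mathbb R^{|\mathcal S|\times|\mathcal S|\times|\mathcal A|}$ is nonempty, compact and $(s,a)$-rectangular: $\mathcal U=\prod_{s,a}\mathcal U_{s,a}$ with $\mathcal U_{s,a}=\{u(\cdot|s,a):u\in\mathcal U\}$; for every $u\in\mathcal U$, $\mathbb P_u(\cdot|s,a)=\mathbb P_N(\cdot|s,a)+u(\cdot|s,a)$ is a transition kernel. $\Pi$ is the set of stationary randomized policies ($\pi(\cdot|s)\in\Delta_{\mathcal A}$ for all $s$). Values. $V^\pi_u(s)=\mathbb E[\sum_{t\ge0}\gamma^t c(s_t,a_t)\mid s_0=s]$ with $a_t\sim\pi(\cdot|s_t)$, $s_{t+1}\sim\mathbb P_u(\cdot|s_t,a_t)$; $Q^\pi_u(s,a)$ is the same with in addition $a_0=a$. Robust values: $V^\pi_r(s)=\max_{u\in\mathcal U}V^\pi_u(s)$,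 $Q^\pi_r(s,a)=\max_{u\in\mathcal U}Q^\pi_u(s,a)$. $u_\pi\in\mathcal U$ denotes a worst-case uncertainty of $\pi$: $u_\pi(\cdot|s,a)\in\operatorname{Argmax}_{u(\cdot|s,a)\in\mathcal U_{s,a}}\sum_{s'}\mathbb P_u(s'|s,a)V^\pi_r(s')$ for all $(s,a)$ (if not unique, one is chosen by an arbitrary deterministic rule). $\langle Q,\pi\rangle_s=\sum_a Q(s,a)\pi(a|s)$. $d^{\pi,u}_s(s')=(1-\gamma)\sum_{t\ge0}\gamma^t\Pr(s_t=s'\mid s_0=s)$ under policy $\pi$ and kernel $\mathbb P_u$. *)

theory Defs
  imports "HOL-Probability.Probability"
begin

text \<open>
  States and actions are arbitrary types \<open>'s\<close>, \<open>'a\<close> of class \<^class>\<open>finite\<close>. A probability vector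
  on such a type is a \<open>pmf\<close>: a stationary randomized policy has type \<open>'s \<Rightarrow> 'a pmf\<close>, the nominal
  kernel has type \<open>'s \<Rightarrow> 'a \<Rightarrow> 's pmf\<close>. An uncertainty \<open>u\<close> is a vector with component
  \<open>u(s'|s,a)\<close> at the index \<open>(s', s, a)\<close>.
\<close>

type_synonym ('s, 'a) policy = "'s \<Rightarrow> 'a pmf"
type_synonym ('s, 'a) kernel = "'s \<Rightarrow> 'a \<Rightarrow> 's pmf"
type_synonym ('s, 'a) uncertainty = "real ^ ('s \<times> 's \<times> 'a)"

definition slice :: "('s::finite, 'a::finite) uncertainty \<Rightarrow> 's \<Rightarrow> 'a \<Rightarrow> real ^ 's" where
  "slice u s a = (\<chi> s'. u $ (s', s, a))"

definition slices :: "('s::finite, 'a::finite) uncertainty set \<Rightarrow> 's \<Rightarrow> 'a \<Rightarrow> (real ^ 's) set" where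
  "slices U s a = (\<lambda>u. slice u s a) ` U"

definition sa_rectangular :: "('s::finite, 'a::finite) uncertainty set \<Rightarrow> bool" where
  "sa_rectangular U \<longleftrightarrow> U = {u. \<forall>s a. slice u s a \<in> slices U s a}"

definition perturbed :: "('s::finite, 'a::finite) kernel \<Rightarrow> ('s, 'a) uncertainty \<Rightarrow> 's \<Rightarrow> 'a \<Rightarrow> 's \<Rightarrow> real"
  where "perturbed PN u s a s' = pmf (PN s a) s' + u $ (s', s, a)"

definition transition_kernel :: "('s::finite \<Rightarrow> 'a::finite \<Rightarrow> 's \<Rightarrow> real) \<Rightarrow> bool" where
  "transition_kernel P \<longleftrightarrow> (\<forall>s a. (\<forall>s'. 0 \<le> P s a s') \<and> (\<Sum>s'\<in>UNIV. P s a s') = 1)"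

text \<open>
  The \<open>pmf\<close> with weights \<open>perturbed PN u s a\<close>. It is only meaningful if these weights form a
  probability vector, i.e. under \<^term>\<open>transition_kernel (perturbed PN u)\<close>.
\<close>
definition pert_kernel :: "('s::finite, 'a::finite) kernel \<Rightarrow> ('s, 'a) uncertainty \<Rightarrow> ('s, 'a) kernel"
  where "pert_kernel PN u s a = embed_pmf (perturbed PN u s a)"

lemma pmf_pert_kernel:
  assumes "transition_kernel (perturbed PN u)"
  shows "pmf (pert_kernel PN u s a) s' = perturbed PN u s a s'"
  unfolding pert_kernel_def
  using assms
  by (intro pmf_embed_pmf)
     (auto simp: transition_kernel_def nn_integral_count_space_finite)

definition start :: "('s::finite, 'a::finite) policy \<Rightarrow> 's \<Rightarrow> ('s \<times> 'a) pmf" where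
  "start \<pi> s = map_pmf (Pair s) (\<pi> s)"

definition step :: "('s::finite, 'a::finite) kernel \<Rightarrow> ('s, 'a) policy \<Rightarrow> 's \<times> 'a \<Rightarrow> ('s \<times> 'a) pmf" where
  "step P \<pi> = (\<lambda>(s, a). bind_pmf (P s a) (start \<pi>))"

text \<open>
  The law of the trajectory \<open>t \<mapsto> (s\<^sub>t, a\<^sub>t)\<close> on \<open>(\<S> \<times> \<A>)\<^sup>\<nat>\<close>, given the law \<open>\<mu>\<close> of \<open>(s\<^sub>0, a\<^sub>0)\<close>, is the
  measure of the Ionescu-Tulcea theorem. \<open>traj_kernel P \<pi> \<mu> i \<omega>\<close> is the conditional law of
  coordinate \<open>i\<close> given the coordinates \<open>\<omega>\<close> below \<open>i\<close>.
\<close>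
definition traj_kernel ::
  "('s::finite, 'a::finite) kernel \<Rightarrow> ('s, 'a) policy \<Rightarrow> ('s \<times> 'a) pmf \<Rightarrow>
   nat \<Rightarrow> (nat \<Rightarrow> 's \<times> 'a) \<Rightarrow> ('s \<times> 'a) measure" where
  "traj_kernel P \<pi> \<mu> i \<omega> = measure_pmf (if i = 0 then \<mu> else step P \<pi> (\<omega> (i - 1)))"

lemma Ionescu_Tulcea_traj:
  "Ionescu_Tulcea (traj_kernel P \<pi> \<mu>) (\<lambda>_. count_space UNIV)"
proof (rule Ionescu_Tulcea.intro)
  fix i :: nat
  show "traj_kernel P \<pi> \<mu> i \<in>
    PiM {0..<i} (\<lambda>_. count_space UNIV) \<rightarrow>\<^sub>M subprob_algebra (count_space UNIV)"
  proof (cases "i = 0")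
    case True
    then show ?thesis
      by (simp add: traj_kernel_def[abs_def] space_subprob_algebra prob_space_imp_subprob_space
          measure_pmf.prob_space_axioms)
  next
    case False
    have "(\<lambda>\<omega>. \<omega> (i - 1)) \<in> PiM {0..<i} (\<lambda>_. count_space UNIV) \<rightarrow>\<^sub>M count_space (UNIV :: ('s \<times> 'a) set)"
      using False by (intro measurable_component_singleton) auto
    moreover have "(\<lambda>x. measure_pmf (step P \<pi> x)) \<in> count_space UNIV \<rightarrow>\<^sub>M subprob_algebra (count_space UNIV)"
      by (simp add: space_subprob_algebra prob_space_imp_subprob_space
          measure_pmf.prob_space_axioms)
    ultimately show ?thesis
      using False by (simp add: traj_kernel_def[abs_def] measurable_compose)
  qed
next
  show "prob_space (traj_kernel P \<pi> \<mu> i x)" for i x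
    by (simp add: traj_kernel_def measure_pmf.prob_space_axioms)
qed

definition traj_law ::
  "('s::finite, 'a::finite) kernel \<Rightarrow> ('s, 'a) policy \<Rightarrow> ('s \<times> 'a) pmf \<Rightarrow> (nat \<Rightarrow> 's \<times> 'a) measure" where
  "traj_law P \<pi> \<mu> =
     projective_family.lim UNIV (Ionescu_Tulcea.CI (traj_kernel P \<pi> \<mu>) (\<lambda>_. count_space UNIV))
       (\<lambda>_. count_space UNIV)"

lemma prob_space_traj_law: "prob_space (traj_law P \<pi> \<mu>)"
proof -
  interpret Ionescu_Tulcea "traj_kernel P \<pi> \<mu>" "\<lambda>_. count_space UNIV"
    by (rule Ionescu_Tulcea_traj)
  have "prob_space (distr PF.lim (PiM {} (\<lambda>_. count_space UNIV)) (\<lambda>x. restrict x {}))"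
    by (subst distr_lim) (auto intro: PF.prob_space_P)
  then have "prob_space PF.lim"
    by (rule prob_space_distrD[rotated])
       (auto intro!: measurable_restrict simp: measurable_cong_sets[OF PF.sets_lim refl])
  then show ?thesis
    by (simp add: traj_law_def)
qed

definition discounted_cost :: "('s \<Rightarrow> 'a \<Rightarrow> real) \<Rightarrow> real \<Rightarrow> (nat \<Rightarrow> 's \<times> 'a) \<Rightarrow> real" where
  "discounted_cost c \<gamma> \<omega> = (\<Sum>t. \<gamma> ^ t * c (fst (\<omega> t)) (snd (\<omega> t)))"

definition V ::
  "('s::finite \<Rightarrow> 'a::finite \<Rightarrow> real) \<Rightarrow> real \<Rightarrow> ('s, 'a) kernel \<Rightarrow>
   ('s, 'a) policy \<Rightarrow> ('s, 'a) uncertainty \<Rightarrow> 's \<Rightarrow> real" where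
  "V c \<gamma> PN \<pi> u s =
     (\<integral>\<omega>. discounted_cost c \<gamma> \<omega> \<partial>traj_law (pert_kernel PN u) \<pi> (start \<pi> s))"

definition Q ::
  "('s::finite \<Rightarrow> 'a::finite \<Rightarrow> real) \<Rightarrow> real \<Rightarrow> ('s, 'a) kernel \<Rightarrow>
   ('s, 'a) policy \<Rightarrow> ('s, 'a) uncertainty \<Rightarrow> 's \<Rightarrow> 'a \<Rightarrow> real" where
  "Q c \<gamma> PN \<pi> u s a =
     (\<integral>\<omega>. discounted_cost c \<gamma> \<omega> \<partial>traj_law (pert_kernel PN u) \<pi> (return_pmf (s, a)))"

text \<open>
  The robust values are maxima over \<open>U\<close>: for nonempty compact \<open>U\<close>, costs in \<open>(0, 1]\<close> and
  \<open>0 < \<gamma> < 1\<close> the values are bounded and continuous in \<open>u\<close>, so the suprema are attained.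
\<close>
definition V_rob ::
  "('s::finite \<Rightarrow> 'a::finite \<Rightarrow> real) \<Rightarrow> real \<Rightarrow> ('s, 'a) kernel \<Rightarrow>
   ('s, 'a) uncertainty set \<Rightarrow> ('s, 'a) policy \<Rightarrow> 's \<Rightarrow> real" where
  "V_rob c \<gamma> PN U \<pi> s = (SUP u\<in>U. V c \<gamma> PN \<pi> u s)"

definition Q_rob ::
  "('s::finite \<Rightarrow> 'a::finite \<Rightarrow> real) \<Rightarrow> real \<Rightarrow> ('s, 'a) kernel \<Rightarrow>
   ('s, 'a) uncertainty set \<Rightarrow> ('s, 'a) policy \<Rightarrow> 's \<Rightarrow> 'a \<Rightarrow> real" where
  "Q_rob c \<gamma> PN U \<pi> s a = (SUP u\<in>U. Q c \<gamma> PN \<pi> u s a)"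

definition worst_case ::
  "('s::finite \<Rightarrow> 'a::finite \<Rightarrow> real) \<Rightarrow> real \<Rightarrow> ('s, 'a) kernel \<Rightarrow>
   ('s, 'a) uncertainty set \<Rightarrow> ('s, 'a) policy \<Rightarrow> ('s, 'a) uncertainty \<Rightarrow> bool" where
  "worst_case c \<gamma> PN U \<pi> u \<longleftrightarrow> u \<in> U \<and>
     (\<forall>s a. is_arg_max
        (\<lambda>w. \<Sum>s'\<in>UNIV. (pmf (PN s a) s' + w $ s') * V_rob c \<gamma> PN U \<pi> s')
        (\<lambda>w. w \<in> slices U s a)
        (slice u s a))"

definition visitation ::
  "real \<Rightarrow> ('s::finite, 'a::finite) kernel \<Rightarrow> ('s, 'a) policy \<Rightarrow> ('s, 'a) uncertainty \<Rightarrow>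
   's \<Rightarrow> 's \<Rightarrow> real" where
  "visitation \<gamma> PN \<pi> u s s' =
     (1 - \<gamma>) * (\<Sum>t. \<gamma> ^ t *
        measure (traj_law (pert_kernel PN u) \<pi> (start \<pi> s)) {\<omega>. fst (\<omega> t) = s'})"

end

theory Submission
  imports Defs
begin

text \<open>
  For every function \<open>W\<close> on states, telescoping along the trajectory expresses \<open>V\<^sub>u - W\<close> as the
  \<open>1 / (1 - \<gamma>)\<close>-weighted visitation average of \<open>c + \<gamma> P\<^sub>u W - W\<close>. With \<open>W\<close> the robust value of
  the policy and \<open>u\<close> a worst case, maximality of \<open>u\<close> makes the averaged terms nonnegative, so \<open>u\<close>
  attains the robust value at all states simultaneously. Compactness and rectangularity provide a
  worst case for \<open>\<pi>\<close>, which then gives \<open>c + \<gamma> P\<^sub>u V\<^sub>r \<le> Q\<^sub>r\<close> for all \<open>u \<in> U\<close> and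
  \<open>\<langle>Q\<^sub>r, \<pi>\<rangle> \<le> V\<^sub>r\<close>. The theorem is the telescoped identity for \<open>\<pi>'\<close> and \<open>u'\<close> with \<open>W\<close> the robust
  value of \<open>\<pi>\<close>.
\<close>

section \<open>Marginals of the trajectory law\<close>

text \<open>The law of the pair at time \<open>t\<close>, built by iterating the one-step kernel. As
  a \<open>pmf\<close> on a finite type it lets finite sums replace integrals over path
  space.\<close>

primrec marginal ::
  "('s::finite, 'a::finite) kernel \<Rightarrow> ('s, 'a) policy \<Rightarrow> ('s \<times> 'a) pmf \<Rightarrow> nat \<Rightarrow> ('s \<times> 'a) pmf" where
  "marginal P \<pi> \<mu> 0 = \<mu>"
| "marginal P \<pi> \<mu> (Suc t) = bind_pmf (marginal P \<pi> \<mu> t) (step P \<pi>)"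

section \<open>Coordinate laws of the Ionescu-Tulcea measure\<close>

lemma sets_traj_law: "sets (traj_law P \<pi> \<mu>) = sets (PiM UNIV (\<lambda>_. count_space UNIV))"
proof -
  interpret Ionescu_Tulcea "traj_kernel P \<pi> \<mu>" "\<lambda>_. count_space UNIV"
    by (rule Ionescu_Tulcea_traj)
  show ?thesis
    by (simp add: traj_law_def)
qed

lemma measurable_traj_coord [measurable]:
  "(\<lambda>\<omega>. \<omega> t) \<in> traj_law P \<pi> \<mu> \<rightarrow>\<^sub>M count_space UNIV"
  by (simp add: measurable_cong_sets[OF sets_traj_law refl] measurable_component_singleton)

text \<open>Coordinate \<open>t\<close> depends only on the first \<open>t + 1\<close> coordinates.
  The projection of the limit measure to these is the finite iterate \<open>C 0 (Suc t)\<close> of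
  the kernels, which can be computed by induction.\<close>

lemma nn_integral_traj_coord:
  fixes f :: "'s::finite \<times> 'a::finite \<Rightarrow> ennreal"
  shows "(\<integral>\<^sup>+\<omega>. f (\<omega> t) \<partial>traj_law P \<pi> \<mu>) = (\<integral>\<^sup>+x. f x \<partial>marginal P \<pi> \<mu> t)"
proof -
  interpret Ionescu_Tulcea "traj_kernel P \<pi> \<mu>" "\<lambda>_. count_space UNIV"
    by (rule Ionescu_Tulcea_traj)
  let ?M = "\<lambda>J. PiM J (\<lambda>_. count_space (UNIV :: ('s \<times> 'a) set))"
  \<comment> \<open>The function constantly \<open>undefined\<close> is the only point of the
    product over the empty index set; it serves as the empty history.\<close>
  let ?C = "\<lambda>n. C 0 n (\<lambda>_. undefined)"
  have undef: "(\<lambda>_. undefined) \<in> space (?M {0..<0})"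
    by (simp add: space_PiM PiE_def extensional_def)
  have coord [measurable]: "(\<lambda>\<omega>. f (\<omega> t)) \<in> borel_measurable (?M {0..<Suc t})" for f :: "'s \<times> 'a \<Rightarrow> ennreal" and t
    by (rule measurable_compose[OF measurable_component_singleton[of t]]) auto
  \<comment> \<open>The integrand must be arbitrary: the induction step integrates out the last
    transition, which replaces \<open>f\<close> by its one-step expectation.\<close>
  have C: "(\<integral>\<^sup>+\<omega>. f (\<omega> t) \<partial>?C (Suc t)) = (\<integral>\<^sup>+x. f x \<partial>marginal P \<pi> \<mu> t)"
    for f :: "'s \<times> 'a \<Rightarrow> ennreal"
  proof (induction t arbitrary: f)
    case 0
    have "(\<integral>\<^sup>+\<omega>. f (\<omega> 0) \<partial>?C (Suc 0)) = (\<integral>\<^sup>+\<omega>. f (\<omega> 0) \<partial>eP 0 (\<lambda>_. undefined))"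
      using bind_return[OF measurable_eP undef] by simp
    also have "\<dots> = (\<integral>\<^sup>+x. f x \<partial>\<mu>)"
      using coord[of f 0] by (subst nn_integral_eP[OF undef]) (auto simp: traj_kernel_def)
    finally show ?case
      by simp
  next
    case (Suc t)
    have "eP (Suc t) \<in> ?C (Suc t) \<rightarrow>\<^sub>M subprob_algebra (?M {0..<Suc (Suc t)})"
      using measurable_eP[of "Suc t"]
      unfolding measurable_cong_sets[OF sets_C[OF undef, of "Suc t"] refl] by simp
    then have "(\<integral>\<^sup>+\<omega>. f (\<omega> (Suc t)) \<partial>?C (Suc (Suc t))) =
        (\<integral>\<^sup>+\<omega>. \<integral>\<^sup>+\<omega>'. f (\<omega>' (Suc t)) \<partial>eP (Suc t) \<omega> \<partial>?C (Suc t))"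
      by (subst C.simps(2), subst nn_integral_bind[where B = "?M {0..<Suc (Suc t)}"])
         (auto simp del: C.simps)
    also have "\<dots> = (\<integral>\<^sup>+\<omega>. (\<integral>\<^sup>+y. f y \<partial>step P \<pi> (\<omega> t)) \<partial>?C (Suc t))"
      using undef
      by (intro nn_integral_cong, subst nn_integral_eP)
         (auto simp: space_C traj_kernel_def simp del: C.simps)
    also have "\<dots> = (\<integral>\<^sup>+x. f x \<partial>marginal P \<pi> \<mu> (Suc t))"
      by (subst Suc.IH) simp
    finally show ?case .
  qed
  \<comment> \<open>\<open>CI J\<close> is the projection of \<open>C 0 (up_to J)\<close>, so this
    identifies the number of iterated kernels behind the first \<open>t + 1\<close>
    coordinates.\<close>
  have up: "up_to {0..<Suc t} = Suc t"
    by (intro antisym) (use up_to_less[of "{0..<Suc t}" t] in \<open>auto simp: up_to_iff Suc_le_eq\<close>)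
  have R [measurable]: "(\<lambda>\<omega>. restrict \<omega> {0..<Suc t}) \<in> measurable (?M I) (?M {0..<Suc t})"
    if "{0..<Suc t} \<subseteq> I" for I
    using that by (intro measurable_restrict_subset) auto
  have "(\<integral>\<^sup>+\<omega>. f (\<omega> t) \<partial>PF.lim) = (\<integral>\<^sup>+\<omega>. f (\<omega> t) \<partial>distr PF.lim (?M {0..<Suc t}) (\<lambda>\<omega>. restrict \<omega> {0..<Suc t}))"
    using R[of UNIV] coord[of f t]
    by (subst nn_integral_distr) (auto simp: measurable_cong_sets[OF PF.sets_lim refl])
  also have "\<dots> = (\<integral>\<^sup>+\<omega>. f (\<omega> t) \<partial>CI {0..<Suc t})"
    by (subst distr_lim) auto
  also have "\<dots> = (\<integral>\<^sup>+\<omega>. f (\<omega> t) \<partial>?C (Suc t))"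
    unfolding CI_def up using R[of "{0..<Suc t}"] coord[of f t]
    by (subst nn_integral_distr) (auto simp: measurable_cong_sets[OF sets_C[OF undef] refl] simp del: C.simps)
  finally show ?thesis
    by (simp add: traj_law_def C del: C.simps)
qed

lemma distr_traj_coord:
  "distr (traj_law P \<pi> \<mu>) (count_space UNIV) (\<lambda>\<omega>. \<omega> t) = measure_pmf (marginal P \<pi> \<mu> t)"
proof (rule measure_eqI)
  fix A assume A: "A \<in> sets (distr (traj_law P \<pi> \<mu>) (count_space UNIV) (\<lambda>\<omega>. \<omega> t))"
  have "emeasure (distr (traj_law P \<pi> \<mu>) (count_space UNIV) (\<lambda>\<omega>. \<omega> t)) A =
      (\<integral>\<^sup>+x. indicator A x \<partial>distr (traj_law P \<pi> \<mu>) (count_space UNIV) (\<lambda>\<omega>. \<omega> t))"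
    using A by simp
  also have "\<dots> = (\<integral>\<^sup>+\<omega>. indicator A (\<omega> t) \<partial>traj_law P \<pi> \<mu>)"
    by (rule nn_integral_distr) auto
  also have "\<dots> = emeasure (marginal P \<pi> \<mu> t) A"
    by (subst nn_integral_traj_coord) simp
  finally show "emeasure (distr (traj_law P \<pi> \<mu>) (count_space UNIV) (\<lambda>\<omega>. \<omega> t)) A = emeasure (marginal P \<pi> \<mu> t) A" .
qed simp

lemma integral_traj_coord:
  fixes f :: "'s::finite \<times> 'a::finite \<Rightarrow> real"
  shows "(\<integral>\<omega>. f (\<omega> t) \<partial>traj_law P \<pi> \<mu>) = measure_pmf.expectation (marginal P \<pi> \<mu> t) f"
  unfolding distr_traj_coord[symmetric] by (rule integral_distr[symmetric]) auto

lemma integrable_traj_coord: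
  fixes f :: "'s::finite \<times> 'a::finite \<Rightarrow> real"
  shows "integrable (traj_law P \<pi> \<mu>) (\<lambda>\<omega>. f (\<omega> t))"
proof -
  have "integrable (distr (traj_law P \<pi> \<mu>) (count_space UNIV) (\<lambda>\<omega>. \<omega> t)) f"
    unfolding distr_traj_coord by (rule integrable_measure_pmf_finite) simp
  then show ?thesis
    by (rule integrable_distr[rotated]) simp
qed

lemma measure_traj_state:
  "measure (traj_law P \<pi> \<mu>) {\<omega>. fst (\<omega> t) = s'} = pmf (map_pmf fst (marginal P \<pi> \<mu> t)) s'"
proof -
  have "pmf (map_pmf fst (marginal P \<pi> \<mu> t)) s' =
      measure (distr (traj_law P \<pi> \<mu>) (count_space UNIV) (\<lambda>\<omega>. \<omega> t)) (fst -` {s'})"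
    by (simp add: distr_traj_coord pmf_map)
  also have "\<dots> = measure (traj_law P \<pi> \<mu>) ((\<lambda>\<omega>. \<omega> t) -` (fst -` {s'}) \<inter> space (traj_law P \<pi> \<mu>))"
    by (rule measure_distr) auto
  \<comment> \<open>Every function is a path, because the index set and all factors are full types;
    the intersection with the space disappears.\<close>
  also have "(\<lambda>\<omega>. \<omega> t) -` (fst -` {s'}) \<inter> space (traj_law P \<pi> \<mu>) = {\<omega>. fst (\<omega> t) = s'}"
    by (auto simp: sets_eq_imp_space_eq[OF sets_traj_law] space_PiM)
  finally show ?thesis
    by simp
qed

section \<open>Markov structure of the marginals\<close>

lemma marginal_bind: "marginal P \<pi> (bind_pmf p f) t = bind_pmf p (\<lambda>x. marginal P \<pi> (f x) t)"
  by (induction t) (simp_all add: bind_assoc_pmf)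

text \<open>Peels off the first transition where the recursion peels off the last one; the Bellman
  recursion rests on this form.\<close>

lemma marginal_Suc_shift: "marginal P \<pi> \<mu> (Suc t) = marginal P \<pi> (bind_pmf \<mu> (step P \<pi>)) t"
  by (induction t) simp_all

lemma map_fst_start: "map_pmf fst (start \<pi> s) = return_pmf s"
  by (simp add: start_def pmf.map_comp o_def)

lemma map_fst_step: "map_pmf fst (step P \<pi> x) = P (fst x) (snd x)"
  by (simp add: step_def map_bind_pmf map_fst_start bind_return_pmf' split: prod.split)

text \<open>Both the initial law and every transition end by drawing the action from \<pi> at the
  current state. Hence the law of the pair is determined by the law of the state.\<close>

lemma marginal_start:
  "marginal P \<pi> (start \<pi> s) t = bind_pmf (map_pmf fst (marginal P \<pi> (start \<pi> s) t)) (start \<pi>)"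
proof (cases t)
  case 0
  then show ?thesis
    by (simp add: map_fst_start bind_return_pmf)
next
  case (Suc n)
  then show ?thesis
    by (simp add: map_bind_pmf map_fst_step bind_assoc_pmf) (simp add: step_def case_prod_beta')
qed

section \<open>Discounted values\<close>

text \<open>Common form of \<open>V\<close> and \<open>Q\<close>, which differ only in the initial
  law. Allowing any initial law keeps the law after one transition within the same family.\<close>

definition disc_value ::
  "('s::finite \<Rightarrow> 'a::finite \<Rightarrow> real) \<Rightarrow> real \<Rightarrow> ('s, 'a) kernel \<Rightarrow> ('s, 'a) policy \<Rightarrow>
   ('s \<times> 'a) pmf \<Rightarrow> real" where
  "disc_value c \<gamma> P \<pi> \<mu> = (\<integral>\<omega>. discounted_cost c \<gamma> \<omega> \<partial>traj_law P \<pi> \<mu>)"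

lemma V_eq_disc_value: "V c \<gamma> PN \<pi> u s = disc_value c \<gamma> (pert_kernel PN u) \<pi> (start \<pi> s)"
  by (simp add: V_def disc_value_def)

lemma Q_eq_disc_value: "Q c \<gamma> PN \<pi> u s a = disc_value c \<gamma> (pert_kernel PN u) \<pi> (return_pmf (s, a))"
  by (simp add: Q_def disc_value_def)

lemma expectation_finite:
  fixes f :: "'x::finite \<Rightarrow> real"
  shows "measure_pmf.expectation p f = (\<Sum>x\<in>UNIV. pmf p x * f x)"
  by (subst integral_measure_pmf[of UNIV]) auto

lemma expectation_bind_finite:
  fixes h :: "'y::finite \<Rightarrow> real" and p :: "'x::finite pmf"
  shows "measure_pmf.expectation (bind_pmf p f) h =
    measure_pmf.expectation p (\<lambda>x. measure_pmf.expectation (f x) h)"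
  by (subst pmf_expectation_bind[of UNIV]) (auto simp: expectation_finite)

lemma expectation_start:
  fixes f :: "'s::finite \<times> 'a::finite \<Rightarrow> real"
  shows "measure_pmf.expectation (start \<pi> s) f = (\<Sum>a\<in>UNIV. pmf (\<pi> s) a * f (s, a))"
  unfolding start_def integral_map_pmf by (rule expectation_finite)

lemma expectation_bounds:
  fixes f :: "'x::finite \<Rightarrow> real"
  assumes "\<And>x. \<bar>f x\<bar> \<le> B"
  shows "\<bar>measure_pmf.expectation p f\<bar> \<le> B"
proof -
  have "\<bar>measure_pmf.expectation p f\<bar> \<le> measure_pmf.expectation p (\<lambda>x. \<bar>f x\<bar>)"
    by (rule integral_abs_bound)
  also have "\<dots> \<le> measure_pmf.expectation p (\<lambda>_. B)"
    using assms by (intro integral_mono integrable_measure_pmf_finite) auto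
  finally show ?thesis
    by simp
qed

lemma finite_fun_bounded:
  fixes f :: "'x::finite \<Rightarrow> real"
  obtains B where "\<And>x. \<bar>f x\<bar> \<le> B"
proof
  show "\<bar>f x\<bar> \<le> Max (range (\<lambda>x. \<bar>f x\<bar>))" for x
    by (rule Max_ge) auto
qed

section \<open>Series form and Bellman recursion of discounted values\<close>

locale discounted =
  fixes \<gamma> :: real
  assumes \<gamma>_pos: "0 < \<gamma>" and \<gamma>_less_1: "\<gamma> < 1"
begin

lemma summable_disc:
  assumes "\<And>t. \<bar>x t\<bar> \<le> B"
  shows "summable (\<lambda>t. \<gamma> ^ t * x t)"
proof (rule summable_comparison_test')
  show "summable (\<lambda>t. B * \<gamma> ^ t)"
    using \<gamma>_pos \<gamma>_less_1 by (intro summable_mult summable_geometric) auto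
  show "norm (\<gamma> ^ t * x t) \<le> B * \<gamma> ^ t" if "0 \<le> t" for t
    using assms[of t] \<gamma>_pos by (simp add: abs_mult mult.commute mult_left_mono)
qed

text \<open>Costs on a finite type are bounded, so a geometric series dominates and expectation and
  discounted sum may be exchanged. Later identities between values then follow from uniqueness of
  limits of series.\<close>

lemma disc_value_sums:
  fixes c :: "'s::finite \<Rightarrow> 'a::finite \<Rightarrow> real"
  shows "(\<lambda>t. \<gamma> ^ t * measure_pmf.expectation (marginal P \<pi> \<mu> t) (\<lambda>x. c (fst x) (snd x)))
    sums disc_value c \<gamma> P \<pi> \<mu>"
proof -
  obtain B where B: "\<And>x. \<bar>c (fst x) (snd x)\<bar> \<le> B"
    using finite_fun_bounded[of "\<lambda>x. c (fst x) (snd x)"] by blast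
  let ?f = "\<lambda>t \<omega>. \<gamma> ^ t * c (fst (\<omega> t)) (snd (\<omega> t))"
  have int: "integrable (traj_law P \<pi> \<mu>) (?f t)" for t
    using integrable_traj_coord[where f = "\<lambda>x. \<gamma> ^ t * c (fst x) (snd x)" and t = t] by simp
  have norm: "norm (?f t \<omega>) = \<gamma> ^ t * \<bar>c (fst (\<omega> t)) (snd (\<omega> t))\<bar>" for t \<omega>
    using \<gamma>_pos by (simp add: abs_mult)
  have sum_pt: "summable (\<lambda>t. norm (?f t \<omega>))" for \<omega>
    unfolding norm using B by (intro summable_disc[where B = B]) auto
  have "summable (\<lambda>t. \<integral>\<omega>. norm (?f t \<omega>) \<partial>traj_law P \<pi> \<mu>)"
    unfolding norm
    using integral_traj_coord[where f = "\<lambda>x. \<bar>c (fst x) (snd x)\<bar>" and P = P and \<pi> = \<pi> and \<mu> = \<mu>] B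
    by (auto intro!: summable_disc[where B = B] expectation_bounds)
  from sums_integral[OF int _ this] sum_pt
  have "(\<lambda>t. \<integral>\<omega>. ?f t \<omega> \<partial>traj_law P \<pi> \<mu>) sums (\<integral>\<omega>. (\<Sum>t. ?f t \<omega>) \<partial>traj_law P \<pi> \<mu>)"
    by auto
  then show ?thesis
    using integral_traj_coord[where f = "\<lambda>x. c (fst x) (snd x)" and P = P and \<pi> = \<pi> and \<mu> = \<mu>]
    by (simp add: disc_value_def discounted_cost_def)
qed

text \<open>The bound is uniform in the kernel, so the suprema defining the robust values are taken
  over sets bounded above.\<close>

lemma disc_value_bounded:
  fixes c :: "'s::finite \<Rightarrow> 'a::finite \<Rightarrow> real"
  obtains B where "\<And>P \<pi> \<mu>. disc_value c \<gamma> P \<pi> \<mu> \<le> B"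
proof -
  obtain B where B: "\<And>x. \<bar>c (fst x) (snd x)\<bar> \<le> B"
    using finite_fun_bounded[of "\<lambda>x. c (fst x) (snd x)"] by blast
  have "disc_value c \<gamma> P \<pi> \<mu> \<le> B * (1 / (1 - \<gamma>))" for P \<pi> \<mu>
  proof (rule sums_le[OF _ disc_value_sums])
    show "(\<lambda>t. B * \<gamma> ^ t) sums (B * (1 / (1 - \<gamma>)))"
      using \<gamma>_pos \<gamma>_less_1 by (intro sums_mult geometric_sums) auto
    fix t
    have "measure_pmf.expectation (marginal P \<pi> \<mu> t) (\<lambda>x. c (fst x) (snd x)) \<le> B"
      using expectation_bounds[OF B] by (rule order.trans[OF abs_ge_self])
    then show "\<gamma> ^ t * measure_pmf.expectation (marginal P \<pi> \<mu> t) (\<lambda>x. c (fst x) (snd x)) \<le> B * \<gamma> ^ t"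
      using \<gamma>_pos by (simp add: mult.commute mult_left_mono)
  qed
  then show thesis
    by (rule that)
qed

text \<open>Each marginal is affine in the initial law, and the finite mixture commutes with the
  series.\<close>

lemma disc_value_bind:
  fixes p :: "'x::finite pmf"
  shows "disc_value c \<gamma> P \<pi> (bind_pmf p f) = (\<Sum>x\<in>UNIV. pmf p x * disc_value c \<gamma> P \<pi> (f x))"
proof (rule sums_unique2[OF disc_value_sums])
  have "(\<lambda>t. \<Sum>x\<in>UNIV. pmf p x * (\<gamma> ^ t * measure_pmf.expectation (marginal P \<pi> (f x) t) (\<lambda>x. c (fst x) (snd x))))
      sums (\<Sum>x\<in>UNIV. pmf p x * disc_value c \<gamma> P \<pi> (f x))"
    by (intro sums_sum sums_mult disc_value_sums)
  then show "(\<lambda>t. \<gamma> ^ t * measure_pmf.expectation (marginal P \<pi> (bind_pmf p f) t) (\<lambda>x. c (fst x) (snd x)))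
      sums (\<Sum>x\<in>UNIV. pmf p x * disc_value c \<gamma> P \<pi> (f x))"
    by (simp add: marginal_bind expectation_bind_finite expectation_finite[of p] sum_distrib_left mult.left_commute)
qed

lemma disc_value_step:
  "disc_value c \<gamma> P \<pi> \<mu> = measure_pmf.expectation \<mu> (\<lambda>x. c (fst x) (snd x)) +
    \<gamma> * disc_value c \<gamma> P \<pi> (bind_pmf \<mu> (step P \<pi>))"
proof -
  let ?E = "\<lambda>\<mu> t. measure_pmf.expectation (marginal P \<pi> \<mu> t) (\<lambda>x. c (fst x) (snd x))"
  have "(\<lambda>t. \<gamma> * (\<gamma> ^ t * ?E (bind_pmf \<mu> (step P \<pi>)) t)) sums (\<gamma> * disc_value c \<gamma> P \<pi> (bind_pmf \<mu> (step P \<pi>)))"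
    by (intro sums_mult disc_value_sums)
  \<comment> \<open>Time \<open>Suc t\<close> from \<mu> is time \<open>t\<close> from the law after
    one transition; only the term at time 0 remains to be added.\<close>
  then have "(\<lambda>t. \<gamma> ^ Suc t * ?E \<mu> (Suc t)) sums (\<gamma> * disc_value c \<gamma> P \<pi> (bind_pmf \<mu> (step P \<pi>)))"
    by (simp only: marginal_Suc_shift power_Suc mult.assoc)
  from sums_unique2[OF disc_value_sums sums_Suc[OF this]] show ?thesis
    by (simp add: add.commute)
qed

lemma V_eq_sum_Q: "V c \<gamma> PN \<pi> u s = (\<Sum>a\<in>UNIV. pmf (\<pi> s) a * Q c \<gamma> PN \<pi> u s a)"
proof -
  have "start \<pi> s = bind_pmf (\<pi> s) (\<lambda>a. return_pmf (s, a))"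
    by (simp add: start_def map_pmf_def)
  then show ?thesis
    by (simp add: V_eq_disc_value Q_eq_disc_value disc_value_bind)
qed

lemma Q_Bellman:
  "Q c \<gamma> PN \<pi> u s a = c s a + \<gamma> * (\<Sum>s'\<in>UNIV. pmf (pert_kernel PN u s a) s' * V c \<gamma> PN \<pi> u s')"
  unfolding Q_eq_disc_value V_eq_disc_value
  by (subst disc_value_step) (simp add: bind_return_pmf step_def disc_value_bind)

section \<open>Visitation frequencies and performance difference\<close>

lemma visitation_nonneg: "0 \<le> visitation \<gamma> PN \<pi> u s s'"
proof -
  have "summable (\<lambda>t. \<gamma> ^ t * measure (traj_law (pert_kernel PN u) \<pi> (start \<pi> s)) {\<omega>. fst (\<omega> t) = s'})"
    by (intro summable_disc[where B = 1]) (simp add: measure_traj_state pmf_le_1)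
  then show ?thesis
    using \<gamma>_pos \<gamma>_less_1 by (auto simp: visitation_def intro!: mult_nonneg_nonneg suminf_nonneg)
qed

text \<open>Given the state at time \<open>t\<close>, the action has law \<pi>, so the expected cost
  averages the mean cost over the state law. Exchanging the finite sum over states with the series
  in \<open>t\<close> produces the visitation weights.\<close>

lemma disc_value_visitation:
  "disc_value c \<gamma> (pert_kernel PN u) \<pi> (start \<pi> s) =
    1 / (1 - \<gamma>) * (\<Sum>s'\<in>UNIV. visitation \<gamma> PN \<pi> u s s' * (\<Sum>a\<in>UNIV. pmf (\<pi> s') a * c s' a))"
proof -
  let ?P = "pert_kernel PN u"
  let ?m = "\<lambda>t s'. measure (traj_law ?P \<pi> (start \<pi> s)) {\<omega>. fst (\<omega> t) = s'}"
  let ?g = "\<lambda>s'. \<Sum>a\<in>UNIV. pmf (\<pi> s') a * c s' a"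
  have E: "measure_pmf.expectation (marginal ?P \<pi> (start \<pi> s) t) (\<lambda>x. c (fst x) (snd x)) =
      (\<Sum>s'\<in>UNIV. ?m t s' * ?g s')" for t
    by (subst marginal_start)
       (simp only: expectation_bind_finite expectation_start measure_traj_state
         expectation_finite[of "map_pmf fst _"] fst_conv snd_conv)
  have "(\<lambda>t. \<gamma> ^ t * ?m t s') sums (visitation \<gamma> PN \<pi> u s s' / (1 - \<gamma>))" for s'
  proof -
    have "summable (\<lambda>t. \<gamma> ^ t * ?m t s')"
      by (intro summable_disc[where B = 1]) (simp add: measure_traj_state pmf_le_1)
    then show ?thesis
      using \<gamma>_less_1 by (simp add: visitation_def summable_sums)
  qed
  then have "(\<lambda>t. \<Sum>s'\<in>UNIV. \<gamma> ^ t * ?m t s' * ?g s') sums (\<Sum>s'\<in>UNIV. visitation \<gamma> PN \<pi> u s s' / (1 - \<gamma>) * ?g s')"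
    by (intro sums_sum sums_mult2)
  then have "(\<lambda>t. \<gamma> ^ t * (\<Sum>s'\<in>UNIV. ?m t s' * ?g s')) sums
      (1 / (1 - \<gamma>) * (\<Sum>s'\<in>UNIV. visitation \<gamma> PN \<pi> u s s' * ?g s'))"
    by (simp add: sum_distrib_left sum_divide_distrib mult.assoc)
  then show ?thesis
    using sums_unique2[OF disc_value_sums[of ?P \<pi> "start \<pi> s" c]] by (simp only: E)
qed

text \<open>The discounted sum of \<open>\<gamma> W(s\<^sub>t\<^sub>+\<^sub>1) - W(s\<^sub>t)\<close> telescopes to \<open>- W(s\<^sub>0)\<close>.\<close>
lemma performance_difference:
  "V c \<gamma> PN \<pi> u s - W s =
    1 / (1 - \<gamma>) * (\<Sum>s'\<in>UNIV. visitation \<gamma> PN \<pi> u s s' * (\<Sum>a\<in>UNIV. pmf (\<pi> s') a *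
      (c s' a + \<gamma> * (\<Sum>s''\<in>UNIV. pmf (pert_kernel PN u s' a) s'' * W s'') - W s')))"
proof -
  let ?P = "pert_kernel PN u" and ?\<mu> = "start \<pi> s"
  let ?PW = "\<lambda>s a. \<Sum>s'\<in>UNIV. pmf (?P s a) s' * W s'"
  let ?E = "\<lambda>t. measure_pmf.expectation (marginal ?P \<pi> ?\<mu> t)"
  define A where "A t = \<gamma> ^ t * ?E t (\<lambda>x. W (fst x))" for t
  let ?S = "disc_value (\<lambda>s a. W s) \<gamma> ?P \<pi> ?\<mu>"
  have A: "A sums ?S"
    using disc_value_sums[of ?P \<pi> ?\<mu> "\<lambda>s a. W s"] by (simp add: A_def[abs_def])
  have "A 0 = W s"
    by (simp add: A_def expectation_start sum_distrib_right[symmetric] sum_pmf_eq_1)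
  \<comment> \<open>Dropping the first term lowers the sum by \<open>A 0 = W s\<close>; subtracting
    the unshifted series afterwards leaves exactly \<open>- W s\<close>.\<close>
  then have A': "(\<lambda>t. A (Suc t)) sums (?S - W s)"
    using A by (simp add: sums_Suc_iff)
  have "?E (Suc t) (\<lambda>x. W (fst x)) = ?E t (\<lambda>x. ?PW (fst x) (snd x))" for t
  proof -
    have "measure_pmf.expectation (step ?P \<pi> x) (\<lambda>y. W (fst y)) = ?PW (fst x) (snd x)" for x
      using integral_map_pmf[of fst "step ?P \<pi> x" W] by (simp add: map_fst_step expectation_finite[of "?P _ _"])
    then show ?thesis
      by (simp add: expectation_bind_finite)
  qed
  then have "\<gamma> ^ t * ?E t (\<lambda>x. c (fst x) (snd x) + \<gamma> * ?PW (fst x) (snd x) - W (fst x)) =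
      \<gamma> ^ t * ?E t (\<lambda>x. c (fst x) (snd x)) + A (Suc t) - A t" for t
    by (simp add: A_def algebra_simps integrable_measure_pmf_finite)
  moreover have "(\<lambda>t. \<gamma> ^ t * ?E t (\<lambda>x. c (fst x) (snd x)) + A (Suc t) - A t) sums
      (V c \<gamma> PN \<pi> u s + (?S - W s) - ?S)"
    unfolding V_eq_disc_value by (intro sums_add sums_diff disc_value_sums A A')
  \<comment> \<open>The combined series is itself the discounted value of a modified cost, to which
    the visitation formula applies.\<close>
  ultimately have "V c \<gamma> PN \<pi> u s - W s =
      disc_value (\<lambda>s a. c s a + \<gamma> * ?PW s a - W s) \<gamma> ?P \<pi> ?\<mu>"
    using sums_unique2[OF disc_value_sums[of ?P \<pi> ?\<mu> "\<lambda>s a. c s a + \<gamma> * ?PW s a - W s"]] by simp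
  then show ?thesis
    by (simp only: disc_value_visitation)
qed

end

section \<open>Robust values\<close>

locale robust_mdp = discounted \<gamma> for \<gamma> :: real +
  fixes c :: "'s::finite \<Rightarrow> 'a::finite \<Rightarrow> real"
    and PN :: "('s, 'a) kernel"
    and U :: "('s, 'a) uncertainty set"
  assumes U_nonempty: "U \<noteq> {}" and U_compact: "compact U" and U_rect: "sa_rectangular U"
    and U_kernel: "\<And>u. u \<in> U \<Longrightarrow> transition_kernel (perturbed PN u)"
begin

abbreviation "Vr \<equiv> V_rob c \<gamma> PN U"
abbreviation "Qr \<equiv> Q_rob c \<gamma> PN U"

abbreviation backup :: "('s, 'a) uncertainty \<Rightarrow> ('s \<Rightarrow> real) \<Rightarrow> 's \<Rightarrow> 'a \<Rightarrow> real" where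
  "backup u W s a \<equiv> c s a + \<gamma> * (\<Sum>s'\<in>UNIV. pmf (pert_kernel PN u s a) s' * W s')"

lemma backup_mono: "(\<And>s'. W s' \<le> W' s') \<Longrightarrow> backup u W s a \<le> backup u W' s a"
  using \<gamma>_pos by (intro add_left_mono mult_left_mono sum_mono) auto

lemma V_le_Vr: "u \<in> U \<Longrightarrow> V c \<gamma> PN \<pi> u s \<le> Vr \<pi> s"
proof -
  obtain B where "\<And>P \<pi> \<mu>. disc_value c \<gamma> P \<pi> \<mu> \<le> B"
    using disc_value_bounded[of c] by blast
  then have "bdd_above ((\<lambda>u. V c \<gamma> PN \<pi> u s) ` U)"
    by (intro bdd_aboveI2[where M = B]) (simp add: V_eq_disc_value)
  then show "u \<in> U \<Longrightarrow> V c \<gamma> PN \<pi> u s \<le> Vr \<pi> s"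
    unfolding V_rob_def by (rule cSUP_upper2) auto
qed

lemma Q_le_Qr: "u \<in> U \<Longrightarrow> Q c \<gamma> PN \<pi> u s a \<le> Qr \<pi> s a"
proof -
  obtain B where "\<And>P \<pi> \<mu>. disc_value c \<gamma> P \<pi> \<mu> \<le> B"
    using disc_value_bounded[of c] by blast
  then have "bdd_above ((\<lambda>u. Q c \<gamma> PN \<pi> u s a) ` U)"
    by (intro bdd_aboveI2[where M = B]) (simp add: Q_eq_disc_value)
  then show "u \<in> U \<Longrightarrow> Q c \<gamma> PN \<pi> u s a \<le> Qr \<pi> s a"
    unfolding Q_rob_def by (rule cSUP_upper2) auto
qed

section \<open>Worst-case uncertainties: attainment and existence\<close>

lemma expectation_slice:
  assumes "u \<in> U"
  shows "(\<Sum>s'\<in>UNIV. pmf (pert_kernel PN u s a) s' * W s') =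
    (\<Sum>s'\<in>UNIV. (pmf (PN s a) s' + slice u s a $ s') * W s')"
  using U_kernel[OF assms] by (simp add: pmf_pert_kernel perturbed_def slice_def)

text \<open>At a pair \<open>(s, a)\<close> the backup depends on the uncertainty only through its
  slice there, and the slice of \<open>w\<close> maximizes that expression over all slices. The
  positive factor \<gamma> keeps the inequality.\<close>

lemma worst_case_backup:
  assumes "worst_case c \<gamma> PN U \<pi> w" "u \<in> U"
  shows "backup u (Vr \<pi>) s a \<le> backup w (Vr \<pi>) s a"
proof -
  have w: "w \<in> U" and "is_arg_max
      (\<lambda>w. \<Sum>s'\<in>UNIV. (pmf (PN s a) s' + w $ s') * Vr \<pi> s') (\<lambda>w. w \<in> slices U s a) (slice w s a)"
    using assms(1) by (auto simp: worst_case_def)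
  moreover have "slice u s a \<in> slices U s a"
    using assms(2) by (simp add: slices_def)
  ultimately show ?thesis
    using \<gamma>_pos by (auto simp: expectation_slice[OF w] expectation_slice[OF assms(2)] is_arg_max_linorder)
qed

lemma worst_case_attains:
  assumes "worst_case c \<gamma> PN U \<pi> w"
  shows "V c \<gamma> PN \<pi> w s = Vr \<pi> s"
proof (rule antisym)
  show "V c \<gamma> PN \<pi> w s \<le> Vr \<pi> s"
    using assms by (intro V_le_Vr) (simp add: worst_case_def)
  \<comment> \<open>Each \<open>u\<close> satisfies its own Bellman equation; enlarging
    \<open>V\<close> to \<open>Vr\<close> and then \<open>u\<close> to \<open>w\<close> gives a
    bound independent of \<open>u\<close>. So \<open>Vr\<close> is a subsolution of the Bellman
    equation of \<open>w\<close>.\<close>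
  have sup: "Vr \<pi> s \<le> (\<Sum>a\<in>UNIV. pmf (\<pi> s) a * backup w (Vr \<pi>) s a)" for s
    unfolding V_rob_def[of c \<gamma> PN U \<pi> s]
  proof (rule cSUP_least[OF U_nonempty])
    fix u assume u: "u \<in> U"
    have "Q c \<gamma> PN \<pi> u s a \<le> backup w (Vr \<pi>) s a" for a
      unfolding Q_Bellman using worst_case_backup[OF assms u]
      by (rule order.trans[OF backup_mono[OF V_le_Vr[OF u]]])
    then show "V c \<gamma> PN \<pi> u s \<le> (\<Sum>a\<in>UNIV. pmf (\<pi> s) a * backup w (Vr \<pi>) s a)"
      unfolding V_eq_sum_Q by (intro sum_mono mult_left_mono) auto
  qed
  have "0 \<le> (\<Sum>a\<in>UNIV. pmf (\<pi> s) a * (backup w (Vr \<pi>) s a - Vr \<pi> s))" for s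
    using sup[of s] by (simp add: right_diff_distrib sum_subtractf sum_distrib_right[symmetric] sum_pmf_eq_1)
  \<comment> \<open>The performance difference with \<open>W = Vr\<close> turns the subsolution
    property into the missing inequality, without a fixed-point argument.\<close>
  then have "0 \<le> V c \<gamma> PN \<pi> w s - Vr \<pi> s"
    unfolding performance_difference
    using \<gamma>_less_1
    by (intro mult_nonneg_nonneg[OF _ sum_nonneg[OF mult_nonneg_nonneg[OF visitation_nonneg]]]) auto
  then show "Vr \<pi> s \<le> V c \<gamma> PN \<pi> w s"
    by simp
qed

text \<open>Compactness gives a maximizing slice separately at each pair; rectangularity makes the
  uncertainty glued from these slices a member of \<open>U\<close>.\<close>

lemma worst_case_exists: "\<exists>w. worst_case c \<gamma> PN U \<pi> w"
proof -
  let ?f = "\<lambda>s a w. \<Sum>s'\<in>UNIV. (pmf (PN s a) s' + w $ s') * Vr \<pi> s'"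
  have "\<exists>x\<in>slices U s a. \<forall>y\<in>slices U s a. ?f s a y \<le> ?f s a x" for s a
  proof (rule continuous_attains_sup)
    show "compact (slices U s a)"
      unfolding slices_def slice_def
      by (intro compact_continuous_image U_compact continuous_intros)
    show "slices U s a \<noteq> {}"
      using U_nonempty by (simp add: slices_def)
    show "continuous_on (slices U s a) (?f s a)"
      by (intro continuous_intros)
  qed
  then have "\<forall>s. \<exists>x. \<forall>a. x a \<in> slices U s a \<and> (\<forall>y\<in>slices U s a. ?f s a y \<le> ?f s a (x a))"
    by (intro allI choice) blast
  from choice[OF this] obtain x where x: "\<And>s a. x s a \<in> slices U s a"
    "\<And>s a y. y \<in> slices U s a \<Longrightarrow> ?f s a y \<le> ?f s a (x s a)"
    by blast
  \<comment> \<open>The index \<open>i\<close> is a triple \<open>(s', s, a)\<close>: the entry is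
    component \<open>s'\<close> of the maximizer chosen at \<open>(s, a)\<close>.\<close>
  define w :: "('s, 'a) uncertainty" where "w = (\<chi> i. x (fst (snd i)) (snd (snd i)) $ fst i)"
  have slice_w: "slice w s a = x s a" for s a
    by (simp add: slice_def w_def)
  have "w \<in> {u. \<forall>s a. slice u s a \<in> slices U s a}"
    using x(1) by (simp add: slice_w)
  then have "w \<in> U"
    by (rule subsetD[OF equalityD2[OF U_rect[unfolded sa_rectangular_def]]])
  then have "worst_case c \<gamma> PN U \<pi> w"
    using x by (simp add: worst_case_def slice_w is_arg_max_linorder)
  then show ?thesis ..
qed

section \<open>Robust Bellman inequalities and comparison of two policies\<close>

lemma backup_le_Qr:
  assumes "u \<in> U"
  shows "backup u (Vr \<pi>) s a \<le> Qr \<pi> s a"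
proof -
  obtain w where w: "worst_case c \<gamma> PN U \<pi> w"
    using worst_case_exists by blast
  have "backup u (Vr \<pi>) s a \<le> backup w (Vr \<pi>) s a"
    using w assms by (rule worst_case_backup)
  \<comment> \<open>Since \<open>w\<close> attains the robust value at every state simultaneously,
    backing up \<open>Vr\<close> under \<open>w\<close> is the Bellman equation for its own
    \<open>Q\<close>.\<close>
  also have "\<dots> = Q c \<gamma> PN \<pi> w s a"
    by (simp add: Q_Bellman worst_case_attains[OF w])
  also have "\<dots> \<le> Qr \<pi> s a"
    using w by (intro Q_le_Qr) (simp add: worst_case_def)
  finally show ?thesis .
qed

text \<open>An average of suprema can exceed the supremum of averages in general. Here one worst
  case \<open>w\<close> maximizes \<open>Q\<close> at all actions at once, so the average of the
  suprema is at most the value of \<open>w\<close>.\<close>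

lemma sum_Qr_le_Vr: "(\<Sum>a\<in>UNIV. pmf (\<pi> s) a * Qr \<pi> s a) \<le> Vr \<pi> s"
proof -
  obtain w where w: "worst_case c \<gamma> PN U \<pi> w"
    using worst_case_exists by blast
  have "Qr \<pi> s a \<le> Q c \<gamma> PN \<pi> w s a" for a
    unfolding Q_rob_def
  proof (rule cSUP_least[OF U_nonempty])
    fix u assume u: "u \<in> U"
    show "Q c \<gamma> PN \<pi> u s a \<le> Q c \<gamma> PN \<pi> w s a"
      unfolding Q_Bellman worst_case_attains[OF w] using worst_case_backup[OF w u]
      by (rule order.trans[OF backup_mono[OF V_le_Vr[OF u]]])
  qed
  then have "(\<Sum>a\<in>UNIV. pmf (\<pi> s) a * Qr \<pi> s a) \<le> V c \<gamma> PN \<pi> w s"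
    unfolding V_eq_sum_Q by (intro sum_mono mult_left_mono) auto
  then show ?thesis
    by (simp add: worst_case_attains[OF w])
qed

lemma robust_performance_difference:
  assumes w: "worst_case c \<gamma> PN U \<pi>' w"
  shows "Vr \<pi>' s - Vr \<pi> s \<le> 1 / (1 - \<gamma>) * (\<Sum>s'\<in>UNIV. visitation \<gamma> PN \<pi>' w s s' *
    (\<Sum>a\<in>UNIV. Qr \<pi> s' a * (pmf (\<pi>' s') a - pmf (\<pi> s') a)))"
proof -
  have w_in: "w \<in> U"
    using w by (simp add: worst_case_def)
  have "(\<Sum>a\<in>UNIV. pmf (\<pi>' s) a * (backup w (Vr \<pi>) s a - Vr \<pi> s))
      \<le> (\<Sum>a\<in>UNIV. Qr \<pi> s a * (pmf (\<pi>' s) a - pmf (\<pi> s) a))" for s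
  proof -
    have "(\<Sum>a\<in>UNIV. pmf (\<pi>' s) a * (backup w (Vr \<pi>) s a - Vr \<pi> s))
        \<le> (\<Sum>a\<in>UNIV. pmf (\<pi>' s) a * (Qr \<pi> s a - Vr \<pi> s))"
      by (intro sum_mono mult_left_mono diff_right_mono backup_le_Qr w_in pmf_nonneg)
    also have "\<dots> = (\<Sum>a\<in>UNIV. pmf (\<pi>' s) a * Qr \<pi> s a) - Vr \<pi> s"
      by (simp add: right_diff_distrib sum_subtractf sum_distrib_right[symmetric] sum_pmf_eq_1)
    \<comment> \<open>The baseline \<open>Vr\<close> of \<pi> enters with a negative sign, so its
      lower bound by the average of \<open>Qr\<close> under \<pi> is the direction required.\<close>
    also have "\<dots> \<le> (\<Sum>a\<in>UNIV. pmf (\<pi>' s) a * Qr \<pi> s a) - (\<Sum>a\<in>UNIV. pmf (\<pi> s) a * Qr \<pi> s a)"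
      by (intro diff_left_mono sum_Qr_le_Vr)
    also have "\<dots> = (\<Sum>a\<in>UNIV. Qr \<pi> s a * (pmf (\<pi>' s) a - pmf (\<pi> s) a))"
      by (simp add: sum_subtractf algebra_simps)
    finally show ?thesis .
  qed
  then show ?thesis
    \<comment> \<open>Replacing the robust value of \<open>\<pi>'\<close> by the value under
      \<open>w\<close> makes the exact identity applicable; nonnegative visitation weights then
      preserve the statewise bound.\<close>
    unfolding worst_case_attains[OF w, symmetric] performance_difference[of c PN \<pi>' w s "Vr \<pi>"]
    using \<gamma>_less_1
    by (intro mult_left_mono[OF sum_mono[OF mult_left_mono[OF _ visitation_nonneg]]]) auto
qed

end

theorem lemma2p6:
  fixes c :: "'s::finite \<Rightarrow> 'a::finite \<Rightarrow> real"
    and \<gamma> :: real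
    and PN :: "('s, 'a) kernel"
    and U :: "('s, 'a) uncertainty set"
    and \<pi> \<pi>' :: "('s, 'a) policy"
    and u' :: "('s, 'a) uncertainty"
    and s :: 's
  assumes "\<And>s a. 0 < c s a \<and> c s a \<le> 1"
    and "0 < \<gamma>" and "\<gamma> < 1"
    and "U \<noteq> {}" and "compact U" and "sa_rectangular U"
    and "\<And>u. u \<in> U \<Longrightarrow> transition_kernel (perturbed PN u)"
    and "worst_case c \<gamma> PN U \<pi>' u'"
  shows "V_rob c \<gamma> PN U \<pi>' s - V_rob c \<gamma> PN U \<pi> s \<le>
    1 / (1 - \<gamma>) * (\<Sum>s'\<in>UNIV. visitation \<gamma> PN \<pi>' u' s s' *
      (\<Sum>a\<in>UNIV. Q_rob c \<gamma> PN U \<pi> s' a * (pmf (\<pi>' s') a - pmf (\<pi> s') a)))"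
proof -
  interpret robust_mdp \<gamma> c PN U
    by unfold_locales (use assms in auto)
  show ?thesis
    using assms(8) by (rule robust_performance_difference)
qed

end
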